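(* Let $v_0\in\mathbb{R}^n$ and let $\{v_k\}_{k\ge 0}$ be the sequence generated by Semismooth Newton Method I (SNMI), i.e., for each $k\ge 0$, $v_{k+1}$ is the unique solution of $$v_{k+1}=T^{v_k}v_{k+1}.$$ Then $\{v_k\}$ converges to the unique solution $v^*$ of $v=Dv$. Moreover, the sequence is monotone, i.e. $$v_{k+1}\ge v_k\quad\text{(componentwise) for } k=1,2,3,\dots$$
   Context: Setting. $\mathcal{S}=\{1,\dots,n\}$ and $\mathcal{A}=\{1,\dots,m\}$ are finite state and action sets, $\mathcal{A}(i)\subseteq\mathcal{A}$ is the nonempty set of actions allowed in state $i$, $\gamma\in(0,1)$ is the discount factor, $\mathbb{S}^n$ is the probability simplex in $\mathbb{R}^n$, $P:\mathcal{S}\times\mathcal{A}\to\mathbb{S}^n$ is the controlled kernel and $g:\mathcal{S}\times\mathcal{A}\to[-R,R]$, $R>0$, is the stage cost. $\Pi$ is the finite set of policies $\pi:\mathcal{S}\to\mathcal{A}$ with $\pi(i)\in\mathcal{A}(i)$ for all $i$; $g_\pi\in\mathbb{R}^n$ has entries $g(i,\pi(i))$. The risk-transition mapping $\chi:\mathbb{R}^n\times\mathbb{S}^n\to\mathbb{R}$ satisfies: for every $(i,a)$ there is a nonempty compact convex set $\mathcal{P}_\chi(P(i,a))\subset\mathbb{S}^n$ such that $\chi(v,P(i,a))=\max_{\tilde p\in\mathcal{P}_\chi(P(i,a))}\langle v,\tilde p\rangle$ for all $v\in\mathbb{R}^n$. The risk-averse Bellman operator $D:\mathbb{R}^n\to\mathbb{R}^n$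 is $(Dv)(i)=\min_{a\in\mathcal{A}(i)}\{g(i,a)+\gamma\,\chi(v,P(i,a))\}$, $i\in\mathcal{S}$; it is a $\gamma$-contraction in the infinity norm with unique fixed point $v^*$. For $\tilde v\in\mathbb{R}^n$ and $\pi\in\Pi$, $P^{\tilde v}_\pi$ is a row-stochastic $n\times n$ matrix whose $i$-th row is a (selected) element of $\arg\max_{p\in\mathcal{P}_\chi(P(i,\pi(i)))}\langle p,\tilde v\rangle$, for each $i\in\mathcal{S}$. The operator $T^{\tilde v}:\mathbb{R}^n\to\mathbb{R}^n$ is $T^{\tilde v}v=\min_{\pi\in\Pi}\{g_\pi+\gamma P^{\tilde v}_\pi v\}$, with the minimum taken componentwise. It is a $\gamma$-contraction in the infinity norm, so it has a unique fixed point. *)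

theory Defs
  imports "HOL-Analysis.Analysis"
begin

text \<open>
  States and actions are the elements of finite types \<open>'s\<close> and \<open>'a\<close>; \<open>act i\<close> is the set
  of actions allowed in state \<open>i\<close>, and \<open>risk v p\<close> is the risk-transition mapping.
\<close>

definition prob_simplex :: "(real ^ 's) set" where
  "prob_simplex = {p. (\<forall>i. 0 \<le> p $ i) \<and> (\<Sum>i\<in>UNIV. p $ i) = 1}"

definition policies :: "('s \<Rightarrow> 'a set) \<Rightarrow> ('s \<Rightarrow> 'a) set" where
  "policies act = {\<pi>. \<forall>i. \<pi> i \<in> act i}"

definition policy_cost :: "('s \<Rightarrow> 'a \<Rightarrow> real) \<Rightarrow> ('s \<Rightarrow> 'a) \<Rightarrow> real ^ 's" where
  "policy_cost g \<pi> = (\<chi> i. g i (\<pi> i))"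

definition risk_bellman ::
  "('s \<Rightarrow> 'a set) \<Rightarrow> real \<Rightarrow> ('s \<Rightarrow> 'a \<Rightarrow> real) \<Rightarrow> ('s \<Rightarrow> 'a \<Rightarrow> real ^ 's) \<Rightarrow>
   (real ^ 's \<Rightarrow> real ^ 's \<Rightarrow> real) \<Rightarrow> real ^ 's \<Rightarrow> real ^ 's" where
  "risk_bellman act \<gamma> g P risk v =
     (\<chi> i. Min ((\<lambda>a. g i a + \<gamma> * risk v (P i a)) ` act i))"

text \<open>
  \<open>is_worst_case_selection\<close> says that, for every \<open>u\<close> and every policy \<open>\<pi>\<close>, each row \<open>i\<close> of the
  matrix \<open>Q u \<pi>\<close> is some maximiser of \<open>p \<bullet> u\<close> over the set \<open>U (P i (\<pi> i))\<close>. The row chosen may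
  depend on \<open>u\<close> and on the whole policy, not only on \<open>\<pi> i\<close>.
\<close>

definition is_worst_case_selection ::
  "('s \<Rightarrow> 'a set) \<Rightarrow> ('s \<Rightarrow> 'a \<Rightarrow> real ^ 's) \<Rightarrow> (real ^ 's \<Rightarrow> (real ^ 's) set) \<Rightarrow>
   (real ^ 's \<Rightarrow> ('s \<Rightarrow> 'a) \<Rightarrow> real ^ 's ^ 's) \<Rightarrow> bool" where
  "is_worst_case_selection act P U Q \<longleftrightarrow>
     (\<forall>u. \<forall>\<pi>\<in>policies act. \<forall>i.
        is_arg_max (\<lambda>p. p \<bullet> u) (\<lambda>p. p \<in> U (P i (\<pi> i))) (row i (Q u \<pi>)))"

definition linearized_bellman ::
  "('s \<Rightarrow> 'a set) \<Rightarrow> real \<Rightarrow> ('s \<Rightarrow> 'a \<Rightarrow> real) \<Rightarrow>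
   (real ^ 's \<Rightarrow> ('s \<Rightarrow> 'a) \<Rightarrow> real ^ 's ^ 's) \<Rightarrow> real ^ 's \<Rightarrow> real ^ 's \<Rightarrow> real ^ 's" where
  "linearized_bellman act \<gamma> g Q u v =
     (\<chi> i. Min ((\<lambda>\<pi>. (policy_cost g \<pi> + \<gamma> *\<^sub>R (Q u \<pi> *v v)) $ i) ` policies act))"

primrec snmi ::
  "('s \<Rightarrow> 'a set) \<Rightarrow> real \<Rightarrow> ('s \<Rightarrow> 'a \<Rightarrow> real) \<Rightarrow>
   (real ^ 's \<Rightarrow> ('s \<Rightarrow> 'a) \<Rightarrow> real ^ 's ^ 's) \<Rightarrow> real ^ 's \<Rightarrow> nat \<Rightarrow> real ^ 's" where
  "snmi act \<gamma> g Q v0 0 = v0"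
| "snmi act \<gamma> g Q v0 (Suc k) =
     (THE w. w = linearized_bellman act \<gamma> g Q (snmi act \<gamma> g Q v0 k) w)"

end

theory Submission
  imports Defs
begin

text \<open>
  Two relations between the operators carry the theorem. Evaluating a worst-case matrix selected
  for \<open>u\<close> at another vector \<open>w\<close> can only underestimate the risk of \<open>w\<close>, so
  \<open>T\<^sup>u w \<le> D w\<close> (\<open>linearized_le_bellman\<close>), while for \<open>w = u\<close> the selection is exact, so
  \<open>T\<^sup>u u = D u\<close> (\<open>linearized_self\<close>). In other words, \<open>D\<close> is the pointwise maximum of the
  \<open>T\<^sup>u\<close>, and the method solves the equation obtained from the operator that touches \<open>D\<close> at the
  current iterate.

  Both \<open>D\<close> and every \<open>T\<^sup>u\<close> are monotone and turn a shift of the argument by a constant \<open>c \<ge> 0\<close>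
  into a shift of the value by at most \<open>\<gamma> c\<close>. For such operators, fixed points exist, and a vector
  \<open>x\<close> with \<open>x \<le> F x\<close> lies below any \<open>y\<close> with \<open>F y \<le> y\<close>, in particular below the fixed point;
  this comparison principle also gives uniqueness.

  Every iterate after the first satisfies \<open>v\<^sub>k = T\<^sup>u v\<^sub>k \<le> D v\<^sub>k\<close>, where \<open>u\<close> is its predecessor
  (the starting point need not, which is why monotonicity begins at \<open>k = 1\<close>). Comparison for
  \<open>D\<close> yields \<open>v\<^sub>k \<le> v\<^sup>*\<close>. Since \<open>D v\<^sub>k\<close> is also the value at \<open>v\<^sub>k\<close> of the operator linearized at
  \<open>v\<^sub>k\<close>, comparison for that operator yields that its fixed point, the next iterate, is at least
  \<open>v\<^sub>k\<close>. Finally, monotonicity shows that the next iterate is even at least \<open>D v\<^sub>k\<close>, so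
  the method advances no slower than value iteration: the gap to \<open>v\<^sup>*\<close> shrinks by the factor
  \<open>\<gamma>\<close> in each step.
\<close>

section \<open>Monotone discounted operators\<close>

text \<open>
  Monotonicity (the case \<open>c = 0\<close>) and contraction in the maximum norm (apply the property with the
  maximum distance as \<open>c\<close>, in both directions) are combined in one one-sided condition, so that
  one estimate suffices for each concrete operator and the maximum norm itself does not have to
  appear next to the Euclidean norm of the type.
\<close>

definition discounted :: "real \<Rightarrow> (real ^ 'n \<Rightarrow> real ^ 'n) \<Rightarrow> bool" where
  "discounted \<gamma> F \<longleftrightarrow>
     (\<forall>x y c. 0 \<le> c \<longrightarrow> (\<forall>i. x $ i \<le> y $ i + c) \<longrightarrow> (\<forall>i. F x $ i \<le> F y $ i + \<gamma> * c))"

lemma discountedD: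
  assumes "discounted \<gamma> F" "0 \<le> c" "\<And>i. x $ i \<le> y $ i + c"
  shows "F x $ i \<le> F y $ i + \<gamma> * c"
  using assms unfolding discounted_def by blast

lemma discounted_mono:
  assumes "discounted \<gamma> F" "x \<le> y"
  shows "F x \<le> F y"
  using discountedD[OF assms(1), of 0 x y] assms(2) by (simp add: less_eq_vec_def)

lemma discounted_funpow:
  assumes "discounted \<gamma> F" "0 \<le> \<gamma>"
  shows "discounted (\<gamma> ^ n) (F ^^ n)"
proof (induction n)
  case 0
  show ?case by (simp add: discounted_def)
next
  case (Suc n)
  show ?case
    unfolding discounted_def
  proof (intro allI impI)
    fix x y :: "real ^ 'a" and c :: real and i
    assume "0 \<le> c" "\<forall>i. x $ i \<le> y $ i + c"
    then have "(F ^^ n) x $ j \<le> (F ^^ n) y $ j + \<gamma> ^ n * c" for j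
      using Suc.IH by (simp add: discounted_def)
    then have "F ((F ^^ n) x) $ i \<le> F ((F ^^ n) y) $ i + \<gamma> * (\<gamma> ^ n * c)"
      using assms(2) \<open>0 \<le> c\<close> by (intro discountedD[OF assms(1)]) auto
    then show "(F ^^ Suc n) x $ i \<le> (F ^^ Suc n) y $ i + \<gamma> ^ Suc n * c"
      by (simp add: mult.assoc)
  qed
qed

text \<open>
  Passing from the maximum norm to the Euclidean norm costs a factor, bounded here by the
  dimension.
\<close>

lemma discounted_dist_le:
  fixes F :: "real ^ 'n \<Rightarrow> real ^ 'n"
  assumes "discounted \<gamma> F"
  shows "dist (F x) (F y) \<le> real CARD('n) * \<gamma> * dist x y"
proof -
  have close: "x $ i \<le> y $ i + dist x y" for x y :: "real ^ 'n" and i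
    using component_le_norm_cart[of "x - y" i] by (simp add: dist_norm)
  have "\<bar>(F x - F y) $ i\<bar> \<le> \<gamma> * dist x y" for i
    using discountedD[where i = i, OF assms zero_le_dist close[of x _ y]]
      discountedD[where i = i, OF assms zero_le_dist close[of y _ x]]
    by (simp add: dist_commute abs_le_iff)
  then have "(\<Sum>i\<in>UNIV. \<bar>(F x - F y) $ i\<bar>) \<le> real CARD('n) * (\<gamma> * dist x y)"
    using sum_bounded_above[of UNIV "\<lambda>i. \<bar>(F x - F y) $ i\<bar>" "\<gamma> * dist x y"] by simp
  then show ?thesis
    using norm_le_l1_cart[of "F x - F y"] by (simp add: dist_norm mult.assoc)
qed

text \<open>
  A discounted operator need not be a contraction in the Euclidean norm, but a high enough
  iterate of it is, since its modulus \<open>\<gamma> ^ n\<close> absorbs the dimension. The fixed point of the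
  iterate is unique and is mapped by \<open>F\<close> to another fixed point of the iterate, hence to itself.
\<close>

lemma discounted_fixed_point_exists:
  fixes F :: "real ^ 'n \<Rightarrow> real ^ 'n"
  assumes "discounted \<gamma> F" "0 \<le> \<gamma>" "\<gamma> < 1"
  shows "\<exists>x. x = F x"
proof -
  have "(\<lambda>n. real CARD('n) * \<gamma> ^ n) \<longlonglongrightarrow> real CARD('n) * 0"
    using assms by (intro tendsto_intros LIMSEQ_realpow_zero)
  then have "\<forall>\<^sub>F n in sequentially. real CARD('n) * \<gamma> ^ n < 1"
    by (rule order_tendstoD(2)) simp
  then obtain n where n: "real CARD('n) * \<gamma> ^ n < 1"
    by (auto dest: eventually_happens)
  have "\<exists>!x. (F ^^ n) x = x"
  proof (rule banach_fix_type)
    show "\<forall>x y. dist ((F ^^ n) x) ((F ^^ n) y) \<le> real CARD('n) * \<gamma> ^ n * dist x y"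
      using discounted_dist_le[OF discounted_funpow] assms by blast
  qed (use n assms in auto)
  then obtain x where x: "(F ^^ n) x = x" and unique: "\<And>y. (F ^^ n) y = y \<Longrightarrow> y = x"
    by auto
  have "(F ^^ n) (F x) = F ((F ^^ n) x)"
    by (rule funpow_swap1[symmetric])
  then show ?thesis
    using unique[of "F x"] x by metis
qed

text \<open>
  If \<open>c\<close> is the largest excess of \<open>x\<close> over \<open>y\<close>, then passing through \<open>F\<close> shows that the excess
  is at most \<open>\<gamma> c\<close>, which is impossible for \<open>c > 0\<close>.
\<close>

lemma discounted_comparison:
  fixes F :: "real ^ 'n \<Rightarrow> real ^ 'n"
  assumes "discounted \<gamma> F" "\<gamma> < 1" "x \<le> F x" "F y \<le> y"
  shows "x \<le> y"
proof (rule ccontr)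
  assume "\<not> x \<le> y"
  define c where "c = Max (range (\<lambda>i. x $ i - y $ i))"
  have c_upper: "x $ i \<le> y $ i + c" for i
  proof -
    have "x $ i - y $ i \<le> c"
      unfolding c_def by (rule Max_ge) auto
    then show ?thesis by simp
  qed
  have "c \<in> range (\<lambda>i. x $ i - y $ i)"
    unfolding c_def by (rule Max_in) auto
  then obtain m where m: "c = x $ m - y $ m"
    by blast
  obtain j where "y $ j < x $ j"
    using \<open>\<not> x \<le> y\<close> by (auto simp: less_eq_vec_def not_le)
  then have "0 < c"
    using c_upper[of j] by simp
  then have "F x $ m \<le> F y $ m + \<gamma> * c"
    using assms(1) c_upper by (intro discountedD) auto
  moreover have "x $ m \<le> F x $ m" "F y $ m \<le> y $ m"
    using assms(3,4) by (auto simp: less_eq_vec_def)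
  ultimately have "c \<le> \<gamma> * c"
    using m by linarith
  then show False
    using \<open>0 < c\<close> \<open>\<gamma> < 1\<close> by simp
qed

lemma discounted_fixed_point_unique:
  fixes F :: "real ^ 'n \<Rightarrow> real ^ 'n"
  assumes "discounted \<gamma> F" "\<gamma> < 1" "x = F x" "y = F y"
  shows "x = y"
proof -
  have "x \<le> y" "y \<le> x"
    using discounted_comparison[OF assms(1,2)] assms(3,4) by auto
  then show ?thesis
    by (auto simp: less_eq_vec_def vec_eq_iff intro: order_antisym)
qed

lemma Min_image_le_Min_image_plus:
  fixes f h :: "'b \<Rightarrow> real"
  assumes "finite B" "B \<noteq> {}" "\<And>b. b \<in> B \<Longrightarrow> f b \<le> h b + c"
  shows "Min (f ` B) \<le> Min (h ` B) + c"
proof -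
  have "Min (h ` B) \<in> h ` B"
    using assms by (intro Min_in) auto
  then obtain b where b: "b \<in> B" "Min (h ` B) = h b"
    by auto
  have "Min (f ` B) \<le> f b"
    using assms b by (intro Min_le) auto
  then show ?thesis
    using assms(3)[of b] b by linarith
qed

section \<open>The Bellman operator and its linearizations\<close>

lemma prob_simplex_inner_le:
  assumes "p \<in> prob_simplex" "\<And>i. x $ i \<le> y $ i + c"
  shows "p \<bullet> x \<le> p \<bullet> y + c"
proof -
  have "p \<bullet> x \<le> (\<Sum>i\<in>UNIV. p $ i * (y $ i + c))"
    using assms by (auto simp: inner_vec_def prob_simplex_def intro!: sum_mono mult_left_mono)
  also have "\<dots> = p \<bullet> y + (\<Sum>i\<in>UNIV. p $ i) * c"
    by (simp add: inner_vec_def distrib_left sum.distrib sum_distrib_right)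
  finally show ?thesis
    using assms(1) by (simp add: prob_simplex_def)
qed

locale risk_averse_mdp =
  fixes act :: "'s::finite \<Rightarrow> 'a::finite set"
    and \<gamma> :: real
    and P :: "'s \<Rightarrow> 'a \<Rightarrow> real ^ 's"
    and g :: "'s \<Rightarrow> 'a \<Rightarrow> real"
    and risk :: "real ^ 's \<Rightarrow> real ^ 's \<Rightarrow> real"
    and U :: "real ^ 's \<Rightarrow> (real ^ 's) set"
    and Q :: "real ^ 's \<Rightarrow> ('s \<Rightarrow> 'a) \<Rightarrow> real ^ 's ^ 's"
  assumes act_nonempty: "act i \<noteq> {}"
    and discount_pos: "0 < \<gamma>"
    and discount_less_one: "\<gamma> < 1"
    and uncertainty_subset: "U (P i a) \<subseteq> prob_simplex"
    and risk_attained: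
      "\<exists>p. is_arg_max (\<lambda>p. x \<bullet> p) (\<lambda>p. p \<in> U (P i a)) p \<and> risk x (P i a) = x \<bullet> p"
    and worst_case: "is_worst_case_selection act P U Q"
begin

abbreviation D :: "real ^ 's \<Rightarrow> real ^ 's" where
  "D \<equiv> risk_bellman act \<gamma> g P risk"

abbreviation T :: "real ^ 's \<Rightarrow> real ^ 's \<Rightarrow> real ^ 's" where
  "T \<equiv> linearized_bellman act \<gamma> g Q"

lemma inner_le_risk:
  assumes "p \<in> U (P i a)"
  shows "p \<bullet> x \<le> risk x (P i a)"
  using risk_attained[of x i a] assms by (auto simp: is_arg_max_linorder inner_commute)

lemma selection_in_uncertainty:
  assumes "\<pi> \<in> policies act"
  shows "Q u \<pi> $ i \<in> U (P i (\<pi> i))"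
  using worst_case assms
  by (auto simp: is_worst_case_selection_def is_arg_max_def row_def vec_nth_inverse)

text \<open>
  The maximal value does not depend on which maximiser is selected; this is what makes the
  linearization exact at its base point.
\<close>

lemma selection_inner_self:
  assumes "\<pi> \<in> policies act"
  shows "Q u \<pi> $ i \<bullet> u = risk u (P i (\<pi> i))"
proof (rule antisym)
  show "Q u \<pi> $ i \<bullet> u \<le> risk u (P i (\<pi> i))"
    using assms by (intro inner_le_risk selection_in_uncertainty)
next
  obtain p where p: "p \<in> U (P i (\<pi> i))" "risk u (P i (\<pi> i)) = u \<bullet> p"
    using risk_attained[of u i "\<pi> i"] by (auto simp: is_arg_max_def)
  have "is_arg_max (\<lambda>p. p \<bullet> u) (\<lambda>p. p \<in> U (P i (\<pi> i))) (Q u \<pi> $ i)"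
    using worst_case assms by (simp add: is_worst_case_selection_def row_def vec_nth_inverse)
  then show "risk u (P i (\<pi> i)) \<le> Q u \<pi> $ i \<bullet> u"
    using p by (simp add: is_arg_max_linorder inner_commute)
qed

lemma risk_le_risk_plus:
  assumes "\<And>j. x $ j \<le> y $ j + c"
  shows "risk x (P i a) \<le> risk y (P i a) + c"
proof -
  obtain p where p: "p \<in> U (P i a)" "risk x (P i a) = p \<bullet> x"
    using risk_attained[of x i a] by (auto simp: is_arg_max_def inner_commute)
  have "p \<bullet> x \<le> p \<bullet> y + c"
    using p uncertainty_subset assms by (intro prob_simplex_inner_le) auto
  then show ?thesis
    using p inner_le_risk[of p i a y] by linarith
qed

lemma policies_nonempty: "policies act \<noteq> {}"
  using act_nonempty by (auto simp: policies_def ex_in_conv[symmetric] intro!: choice)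

text \<open>
  The minimum in \<open>D\<close> runs over actions and the one in \<open>T u\<close> over policies, because a selected row
  may depend on the whole policy. Modifying a fixed policy in one state shows that both minima can
  be taken over policies, so the two operators can be compared term by term.
\<close>

lemma image_policies: "(\<lambda>\<pi>. \<pi> i) ` policies act = act i"
proof
  show "(\<lambda>\<pi>. \<pi> i) ` policies act \<subseteq> act i"
    by (auto simp: policies_def)
  show "act i \<subseteq> (\<lambda>\<pi>. \<pi> i) ` policies act"
  proof
    fix a assume "a \<in> act i"
    obtain \<pi> where "\<pi> \<in> policies act"
      using policies_nonempty by blast
    then have "\<pi>(i := a) \<in> policies act"
      using \<open>a \<in> act i\<close> by (simp add: policies_def)
    then show "a \<in> (\<lambda>\<pi>. \<pi> i) ` policies act"
      by (intro image_eqI[of _ _ "\<pi>(i := a)"]) auto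
  qed
qed

lemma bellman_nth_policies:
  "D x $ i = Min ((\<lambda>\<pi>. g i (\<pi> i) + \<gamma> * risk x (P i (\<pi> i))) ` policies act)"
proof -
  have "(\<lambda>\<pi>. g i (\<pi> i) + \<gamma> * risk x (P i (\<pi> i))) ` policies act
      = (\<lambda>a. g i a + \<gamma> * risk x (P i a)) ` ((\<lambda>\<pi>. \<pi> i) ` policies act)"
    by (simp add: image_image)
  then show ?thesis
    by (simp only: image_policies) (simp add: risk_bellman_def)
qed

lemma linearized_nth:
  "T u x $ i = Min ((\<lambda>\<pi>. g i (\<pi> i) + \<gamma> * (Q u \<pi> $ i \<bullet> x)) ` policies act)"
  by (simp add: linearized_bellman_def policy_cost_def matrix_vector_mul_component)

lemma linearized_le_bellman: "T u x \<le> D x"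
proof -
  have "Min ((\<lambda>\<pi>. g i (\<pi> i) + \<gamma> * (Q u \<pi> $ i \<bullet> x)) ` policies act)
      \<le> Min ((\<lambda>\<pi>. g i (\<pi> i) + \<gamma> * risk x (P i (\<pi> i))) ` policies act) + 0" for i
    using policies_nonempty discount_pos
    by (intro Min_image_le_Min_image_plus)
      (auto intro!: inner_le_risk selection_in_uncertainty)
  then show ?thesis
    by (simp add: less_eq_vec_def linearized_nth bellman_nth_policies)
qed

lemma linearized_self: "T u u = D u"
  by (simp add: vec_eq_iff linearized_nth bellman_nth_policies selection_inner_self
      cong: image_cong_simp)

lemma discounted_bellman: "discounted \<gamma> D"
  unfolding discounted_def
proof (intro allI impI)
  fix x y :: "real ^ 's" and c :: real and i
  assume "\<forall>i. x $ i \<le> y $ i + c"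
  then have "\<gamma> * risk x (P i a) \<le> \<gamma> * (risk y (P i a) + c)" for a
    using discount_pos by (intro mult_left_mono risk_le_risk_plus) auto
  then show "D x $ i \<le> D y $ i + \<gamma> * c"
    unfolding bellman_nth_policies using policies_nonempty
    by (intro Min_image_le_Min_image_plus) (auto simp: distrib_left add.assoc)
qed

lemma discounted_linearized: "discounted \<gamma> (T u)"
  unfolding discounted_def
proof (intro allI impI)
  fix x y :: "real ^ 's" and c :: real and i
  assume "\<forall>i. x $ i \<le> y $ i + c"
  then have "\<gamma> * (Q u \<pi> $ i \<bullet> x) \<le> \<gamma> * (Q u \<pi> $ i \<bullet> y + c)" if "\<pi> \<in> policies act" for \<pi>
    using discount_pos subsetD[OF uncertainty_subset selection_in_uncertainty[OF that]]
    by (intro mult_left_mono prob_simplex_inner_le) auto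
  then show "T u x $ i \<le> T u y $ i + \<gamma> * c"
    unfolding linearized_nth using policies_nonempty
    by (intro Min_image_le_Min_image_plus) (auto simp: distrib_left add.assoc)
qed

section \<open>Convergence of the semismooth Newton method\<close>

lemma linearized_fixed_point_unique: "x = T u x \<Longrightarrow> y = T u y \<Longrightarrow> x = y"
  using discounted_fixed_point_unique[OF discounted_linearized] discount_less_one by blast

lemma snmi_Suc_fixed_point:
  "snmi act \<gamma> g Q v0 (Suc k) = T (snmi act \<gamma> g Q v0 k) (snmi act \<gamma> g Q v0 (Suc k))"
proof -
  obtain w where w: "w = T (snmi act \<gamma> g Q v0 k) w"
    using discounted_fixed_point_exists[OF discounted_linearized] discount_pos discount_less_one
    by (meson less_imp_le)
  have "snmi act \<gamma> g Q v0 (Suc k) = w"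
    unfolding snmi.simps
  proof (rule the_equality)
    fix x
    assume "x = T (snmi act \<gamma> g Q v0 k) x"
    then show "x = w"
      using w by (rule linearized_fixed_point_unique)
  qed (rule w)
  then show ?thesis
    using w by simp
qed

lemma snmi_le_bellman: "snmi act \<gamma> g Q v0 (Suc k) \<le> D (snmi act \<gamma> g Q v0 (Suc k))"
  by (subst (1) snmi_Suc_fixed_point) (rule linearized_le_bellman)

lemma snmi_increasing: "snmi act \<gamma> g Q v0 (Suc k) \<le> snmi act \<gamma> g Q v0 (Suc (Suc k))"
proof (rule discounted_comparison[OF discounted_linearized discount_less_one])
  let ?u = "snmi act \<gamma> g Q v0 (Suc k)"
  show "?u \<le> T ?u ?u"
    unfolding linearized_self by (rule snmi_le_bellman)
  show "T ?u (snmi act \<gamma> g Q v0 (Suc (Suc k))) \<le> snmi act \<gamma> g Q v0 (Suc (Suc k))"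
    using snmi_Suc_fixed_point[of v0 "Suc k"] by simp
qed

text \<open>
  The method is at least as fast as value iteration: by monotonicity of the operator linearized
  at the current iterate \<open>u\<close>, its fixed point, which lies above \<open>u\<close>, lies above \<open>T u u = D u\<close> too.
\<close>

lemma bellman_le_snmi_Suc:
  "D (snmi act \<gamma> g Q v0 (Suc k)) \<le> snmi act \<gamma> g Q v0 (Suc (Suc k))"
proof -
  let ?u = "snmi act \<gamma> g Q v0 (Suc k)" and ?u' = "snmi act \<gamma> g Q v0 (Suc (Suc k))"
  have "D ?u = T ?u ?u"
    by (rule linearized_self[symmetric])
  also have "\<dots> \<le> T ?u ?u'"
    by (rule discounted_mono[OF discounted_linearized snmi_increasing])
  also have "\<dots> = ?u'"
    by (rule snmi_Suc_fixed_point[symmetric])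
  finally show ?thesis .
qed

lemma snmi_le_fixed_point:
  assumes "w = D w"
  shows "snmi act \<gamma> g Q v0 (Suc k) \<le> w"
  using assms
  by (intro discounted_comparison[OF discounted_bellman discount_less_one snmi_le_bellman]) simp

lemma fixed_point_le_snmi:
  assumes "w = D w"
  shows "w $ i \<le> snmi act \<gamma> g Q v0 (Suc k) $ i + \<gamma> ^ k * dist w (snmi act \<gamma> g Q v0 1)"
proof (induction k arbitrary: i)
  case 0
  show ?case
    using component_le_norm_cart[of "w - snmi act \<gamma> g Q v0 1" i]
    by (simp add: dist_norm)
next
  case (Suc k)
  let ?u = "snmi act \<gamma> g Q v0 (Suc k)" and ?d = "dist w (snmi act \<gamma> g Q v0 1)"
  have "D w $ i \<le> D ?u $ i + \<gamma> * (\<gamma> ^ k * ?d)"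
    using discount_pos Suc.IH by (intro discountedD[OF discounted_bellman]) auto
  moreover have "D ?u $ i \<le> snmi act \<gamma> g Q v0 (Suc (Suc k)) $ i"
    using bellman_le_snmi_Suc[of v0 k] unfolding less_eq_vec_def by blast
  moreover have "D w $ i = w $ i"
    using assms by simp
  ultimately show ?case
    by (simp only: power_Suc mult.assoc)
qed

lemma snmi_tendsto_fixed_point:
  assumes "w = D w"
  shows "snmi act \<gamma> g Q v0 \<longlonglongrightarrow> w"
proof -
  let ?d = "dist w (snmi act \<gamma> g Q v0 1)"
  have "(\<lambda>k. snmi act \<gamma> g Q v0 (Suc k)) \<longlonglongrightarrow> w"
  proof (rule vec_tendstoI)
    fix i
    show "(\<lambda>k. snmi act \<gamma> g Q v0 (Suc k) $ i) \<longlonglongrightarrow> w $ i"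
    proof (rule tendsto_sandwich)
      show "\<forall>\<^sub>F k in sequentially. w $ i - \<gamma> ^ k * ?d \<le> snmi act \<gamma> g Q v0 (Suc k) $ i"
        using fixed_point_le_snmi[OF assms, of i v0]
        by (intro always_eventually allI) (simp only: diff_le_eq)
      show "\<forall>\<^sub>F k in sequentially. snmi act \<gamma> g Q v0 (Suc k) $ i \<le> w $ i"
        using snmi_le_fixed_point[OF assms, of v0] by (simp only: less_eq_vec_def) simp
      have "(\<lambda>k. w $ i - \<gamma> ^ k * ?d) \<longlonglongrightarrow> w $ i - 0 * ?d"
        using discount_pos discount_less_one by (intro tendsto_intros LIMSEQ_realpow_zero) auto
      then show "(\<lambda>k. w $ i - \<gamma> ^ k * ?d) \<longlonglongrightarrow> w $ i"
        by simp
    qed simp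
  qed
  then show ?thesis
    by (rule LIMSEQ_imp_Suc)
qed

end

theorem theorem6:
  fixes act :: "'s::finite \<Rightarrow> 'a::finite set"
    and \<gamma> R :: real
    and P :: "'s \<Rightarrow> 'a \<Rightarrow> real ^ 's"
    and g :: "'s \<Rightarrow> 'a \<Rightarrow> real"
    and risk :: "real ^ 's \<Rightarrow> real ^ 's \<Rightarrow> real"
    and U :: "real ^ 's \<Rightarrow> (real ^ 's) set"
    and Q :: "real ^ 's \<Rightarrow> ('s \<Rightarrow> 'a) \<Rightarrow> real ^ 's ^ 's"
    and v0 :: "real ^ 's"
  defines "D \<equiv> risk_bellman act \<gamma> g P risk"
    and "T \<equiv> linearized_bellman act \<gamma> g Q"
    and "v \<equiv> snmi act \<gamma> g Q v0"
  assumes "\<And>i. act i \<noteq> {}"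
    and "0 < \<gamma>" and "\<gamma> < 1"
    and "\<And>i a. P i a \<in> prob_simplex"
    and "R > 0" and "\<And>i a. g i a \<in> {-R..R}"
    and "\<And>i a. U (P i a) \<noteq> {} \<and> compact (U (P i a)) \<and> convex (U (P i a)) \<and>
                U (P i a) \<subseteq> prob_simplex"
    and "\<And>i a x. \<exists>p. is_arg_max (\<lambda>p. x \<bullet> p) (\<lambda>p. p \<in> U (P i a)) p \<and> risk x (P i a) = x \<bullet> p"
    and "is_worst_case_selection act P U Q"
  shows "(\<forall>k. v (Suc k) = T (v k) (v (Suc k)) \<and> (\<forall>w. w = T (v k) w \<longrightarrow> w = v (Suc k))) \<and>
         (\<exists>vstar. vstar = D vstar \<and> (\<forall>w. w = D w \<longrightarrow> w = vstar) \<and> v \<longlonglongrightarrow> vstar) \<and>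
         (\<forall>k\<ge>1. \<forall>i. v (Suc k) $ i \<ge> v k $ i)"
proof -
  interpret risk_averse_mdp act \<gamma> P g risk U Q
    using assms(4-) by unfold_locales blast+
  obtain w where w: "w = D w"
    unfolding D_def
    using discounted_fixed_point_exists[OF discounted_bellman] discount_pos discount_less_one
    by (meson less_imp_le)
  have "v (Suc k) = T (v k) (v (Suc k))" for k
    unfolding v_def T_def by (rule snmi_Suc_fixed_point)
  moreover have "x = v (Suc k)" if "x = T (v k) x" for x k
    using that snmi_Suc_fixed_point unfolding v_def T_def
    by (rule linearized_fixed_point_unique)
  moreover have "x = w" if "x = D x" for x
    using that w unfolding D_def
    by (rule discounted_fixed_point_unique[OF discounted_bellman discount_less_one])
  moreover have "v \<longlonglongrightarrow> w"
    using w unfolding v_def D_def by (rule snmi_tendsto_fixed_point)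
  moreover have "v k $ i \<le> v (Suc k) $ i" if "k \<ge> 1" for k i
    using that snmi_increasing[of v0 "k - 1"] unfolding v_def less_eq_vec_def by simp
  ultimately show ?thesis
    using w by blast
qed

end
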